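(* Let $\mathcal{C},\mathcal{D},\mathcal{E}$ be small connected categories and let $F,G\colon\mathcal{C}\to\mathcal{D}$ and $H\colon\mathcal{D}\to\mathcal{E}$ be functors. Then $$\mathrm{cD}(H\circ F,H\circ G)\le \mathrm{cD}(F,G).$$
   Context: Interval category: for $m\ge 0$, $\mathcal{I}_m$ has objects $0,1,\dots,m$ and its only non-identity arrows are: exactly one arrow $r\to s$ whenever $r$ is even and $s=r-1$ or $s=r+1$. Two functors $F,G\colon\mathcal{C}\to\mathcal{D}$ between small categories are homotopic, $F\simeq G$, if for some $m\ge 0$ there is a functor $H\colon\mathcal{C}\times\mathcal{I}_m\to\mathcal{D}$ with $H_0=F$ and $H_m=G$ (equivalently, $F$ and $G$ are joined by a finite zigzag of natural transformations). A small category is connected if any two objects are joined by a finite zigzag of arrows. Members of covers (subcategories) are not required to be connected. Geometric cover: a collection $\{\mathcal{U}_\lambda\}_{\lambda\in\Lambda}$ of subcategories of $\mathcal{C}$ such that for every sequence of composable arrows $f_1,\dots,f_n$ in $\mathcal{C}$ there is $\lambda\in\Lambda$ such that every $f_i$ belongs to $\mathcal{U}_\lambda$. Categorical homotopic distance: for functors $F,G\colon\mathcal{C}\to\mathcal{D}$, $\mathrm{cD}(F,G)$ is the least integer $n\ge 0$ such that there is a geometric cover $\{\mathcal{U}_0,\dots,\mathcal{U}_n\}$ of $\mathcal{C}$ with $F_{|\mathcal{U}_j}\simeq G_{|\mathcal{U}_j}$ for all $j$; it is $\infty$ if there is no such cover. *)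

theory Defs
  imports Main "HOL-Library.Extended_Nat"
begin

text \<open>Categories are small: objects and arrows form sets (the carriers \<open>Ob\<close> and \<open>Ar\<close>).
  \<open>Comp C g f\<close> is the composite ``g after f''; it is only meaningful for \<open>Cod f = Dom g\<close>.
  Values of all operations outside the carriers are irrelevant.\<close>

record ('o, 'a) cat =
  Ob :: "'o set"
  Ar :: "'a set"
  Dom :: "'a \<Rightarrow> 'o"
  Cod :: "'a \<Rightarrow> 'o"
  Id :: "'o \<Rightarrow> 'a"
  Comp :: "'a \<Rightarrow> 'a \<Rightarrow> 'a"

locale category =
  fixes C :: "('o, 'a) cat"
  assumes Dom_in: "f \<in> Ar C \<Longrightarrow> Dom C f \<in> Ob C"
    and Cod_in: "f \<in> Ar C \<Longrightarrow> Cod C f \<in> Ob C"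
    and Id_in: "x \<in> Ob C \<Longrightarrow> Id C x \<in> Ar C"
    and Dom_Id: "x \<in> Ob C \<Longrightarrow> Dom C (Id C x) = x"
    and Cod_Id: "x \<in> Ob C \<Longrightarrow> Cod C (Id C x) = x"
    and Comp_in: "\<lbrakk>f \<in> Ar C; g \<in> Ar C; Cod C f = Dom C g\<rbrakk> \<Longrightarrow> Comp C g f \<in> Ar C"
    and Dom_Comp: "\<lbrakk>f \<in> Ar C; g \<in> Ar C; Cod C f = Dom C g\<rbrakk>
      \<Longrightarrow> Dom C (Comp C g f) = Dom C f"
    and Cod_Comp: "\<lbrakk>f \<in> Ar C; g \<in> Ar C; Cod C f = Dom C g\<rbrakk>
      \<Longrightarrow> Cod C (Comp C g f) = Cod C g"
    and Comp_Id_right: "f \<in> Ar C \<Longrightarrow> Comp C f (Id C (Dom C f)) = f"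
    and Comp_Id_left: "f \<in> Ar C \<Longrightarrow> Comp C (Id C (Cod C f)) f = f"
    and Comp_assoc: "\<lbrakk>f \<in> Ar C; g \<in> Ar C; h \<in> Ar C; Cod C f = Dom C g; Cod C g = Dom C h\<rbrakk>
      \<Longrightarrow> Comp C h (Comp C g f) = Comp C (Comp C h g) f"

text \<open>\<open>arrow_rel C\<close> relates x to y if there is an arrow from x to y; a finite zigzag is a path
  in its symmetric closure. Read literally, this makes the empty category connected.\<close>

definition arrow_rel :: "('o, 'a) cat \<Rightarrow> ('o \<times> 'o) set" where
  "arrow_rel C = {(Dom C f, Cod C f) | f. f \<in> Ar C}"

locale connected_category = category +
  assumes connected:
    "\<lbrakk>x \<in> Ob C; y \<in> Ob C\<rbrakk> \<Longrightarrow> (x, y) \<in> (arrow_rel C \<union> (arrow_rel C)\<inverse>)\<^sup>*"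

record ('o, 'a, 'p, 'b) funct =
  omap :: "'o \<Rightarrow> 'p"
  amap :: "'a \<Rightarrow> 'b"

locale cat_functor = S: category C + T: category D
  for C :: "('o, 'a) cat" and D :: "('p, 'b) cat" +
  fixes F :: "('o, 'a, 'p, 'b) funct"
  assumes omap_in: "x \<in> Ob C \<Longrightarrow> omap F x \<in> Ob D"
    and amap_in: "f \<in> Ar C \<Longrightarrow> amap F f \<in> Ar D"
    and Dom_amap: "f \<in> Ar C \<Longrightarrow> Dom D (amap F f) = omap F (Dom C f)"
    and Cod_amap: "f \<in> Ar C \<Longrightarrow> Cod D (amap F f) = omap F (Cod C f)"
    and amap_Id: "x \<in> Ob C \<Longrightarrow> amap F (Id C x) = Id D (omap F x)"
    and amap_Comp: "\<lbrakk>f \<in> Ar C; g \<in> Ar C; Cod C f = Dom C g\<rbrakk>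
      \<Longrightarrow> amap F (Comp C g f) = Comp D (amap F g) (amap F f)"

text \<open>Equality of functors with domain C: the values outside the carriers of C do not count.\<close>

definition funct_eq_on ::
    "('o, 'a) cat \<Rightarrow> ('o, 'a, 'p, 'b) funct \<Rightarrow> ('o, 'a, 'p, 'b) funct \<Rightarrow> bool" where
  "funct_eq_on C F G \<longleftrightarrow>
    (\<forall>x\<in>Ob C. omap F x = omap G x) \<and> (\<forall>f\<in>Ar C. amap F f = amap G f)"

definition funct_comp ::
    "('p, 'b, 'q, 'c) funct \<Rightarrow> ('o, 'a, 'p, 'b) funct \<Rightarrow> ('o, 'a, 'q, 'c) funct" where
  "funct_comp G F = \<lparr>omap = omap G \<circ> omap F, amap = amap G \<circ> amap F\<rparr>"

definition prod_cat ::
    "('o, 'a) cat \<Rightarrow> ('p, 'b) cat \<Rightarrow> ('o \<times> 'p, 'a \<times> 'b) cat" where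
  "prod_cat C D = \<lparr>
    Ob = Ob C \<times> Ob D,
    Ar = Ar C \<times> Ar D,
    Dom = map_prod (Dom C) (Dom D),
    Cod = map_prod (Cod C) (Cod D),
    Id = map_prod (Id C) (Id D),
    Comp = (\<lambda>(g, g') (f, f'). (Comp C g f, Comp D g' f'))\<rparr>"

text \<open>The interval category. Between any two objects there is at most one arrow, so the arrow
  from r to s is encoded as the pair \<open>(r, s)\<close>. The condition s = r - 1 is written
  \<open>r = s + 1\<close> to avoid truncated subtraction at r = 0.\<close>

definition interval_cat :: "nat \<Rightarrow> (nat, nat \<times> nat) cat" where
  "interval_cat m = \<lparr>
    Ob = {0..m},
    Ar = {(r, s). r \<le> m \<and> s \<le> m \<and> (r = s \<or> even r \<and> (r = s + 1 \<or> s = r + 1))},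
    Dom = fst,
    Cod = snd,
    Id = (\<lambda>r. (r, r)),
    Comp = (\<lambda>g f. (fst f, snd g))\<rparr>"

lemma category_interval_cat: "category (interval_cat m)"
  by unfold_locales (auto simp: interval_cat_def)

lemma category_prod_cat:
  assumes "category C" "category D"
  shows "category (prod_cat C D)"
proof -
  interpret C: category C by fact
  interpret D: category D by fact
  show ?thesis
    by unfold_locales
      (auto simp: prod_cat_def C.Dom_in C.Cod_in C.Id_in C.Dom_Id C.Cod_Id C.Comp_in C.Dom_Comp
        C.Cod_Comp C.Comp_Id_right C.Comp_Id_left C.Comp_assoc D.Dom_in D.Cod_in D.Id_in D.Dom_Id
        D.Cod_Id D.Comp_in D.Dom_Comp D.Cod_Comp D.Comp_Id_right D.Comp_Id_left D.Comp_assoc)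
qed

text \<open>The functor \<open>H\<^sub>i\<close> from C to D at an object i of the interval.\<close>

definition funct_at ::
    "('o \<times> nat, 'a \<times> (nat \<times> nat), 'p, 'b) funct \<Rightarrow> nat \<Rightarrow> ('o, 'a, 'p, 'b) funct" where
  "funct_at H i = \<lparr>omap = (\<lambda>x. omap H (x, i)), amap = (\<lambda>f. amap H (f, (i, i)))\<rparr>"

definition homotopic ::
    "('o, 'a) cat \<Rightarrow> ('p, 'b) cat
      \<Rightarrow> ('o, 'a, 'p, 'b) funct \<Rightarrow> ('o, 'a, 'p, 'b) funct \<Rightarrow> bool" where
  "homotopic C D F G \<longleftrightarrow>
    (\<exists>m H. cat_functor (prod_cat C (interval_cat m)) D H
      \<and> funct_eq_on C (funct_at H 0) F \<and> funct_eq_on C (funct_at H m) G)"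

definition subcategory :: "('o, 'a) cat \<Rightarrow> ('o, 'a) cat \<Rightarrow> bool" where
  "subcategory U C \<longleftrightarrow> category U \<and> Ob U \<subseteq> Ob C \<and> Ar U \<subseteq> Ar C
    \<and> (\<forall>f\<in>Ar U. Dom U f = Dom C f \<and> Cod U f = Cod C f)
    \<and> (\<forall>x\<in>Ob U. Id U x = Id C x)
    \<and> (\<forall>f\<in>Ar U. \<forall>g\<in>Ar U. Cod U f = Dom U g \<longrightarrow> Comp U g f = Comp C g f)"

definition composable :: "('o, 'a) cat \<Rightarrow> 'a list \<Rightarrow> bool" where
  "composable C fs \<longleftrightarrow> set fs \<subseteq> Ar C
    \<and> (\<forall>i. Suc i < length fs \<longrightarrow> Cod C (fs ! i) = Dom C (fs ! Suc i))"

definition geometric_cover :: "('o, 'a) cat \<Rightarrow> 'i set \<Rightarrow> ('i \<Rightarrow> ('o, 'a) cat) \<Rightarrow> bool" where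
  "geometric_cover C \<Lambda> U \<longleftrightarrow> (\<forall>l\<in>\<Lambda>. subcategory (U l) C)
    \<and> (\<forall>fs. fs \<noteq> [] \<and> composable C fs \<longrightarrow> (\<exists>l\<in>\<Lambda>. set fs \<subseteq> Ar (U l)))"

text \<open>The restriction of a functor F to a subcategory U is F itself, considered with domain U,
  because functors are only constrained on the carriers of their domain.\<close>

definition cD_le ::
    "('o, 'a) cat \<Rightarrow> ('p, 'b) cat
      \<Rightarrow> ('o, 'a, 'p, 'b) funct \<Rightarrow> ('o, 'a, 'p, 'b) funct \<Rightarrow> nat \<Rightarrow> bool" where
  "cD_le C D F G n \<longleftrightarrow>
    (\<exists>U. geometric_cover C {0..n} U \<and> (\<forall>j\<in>{0..n}. homotopic (U j) D F G))"

definition cD ::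
    "('o, 'a) cat \<Rightarrow> ('p, 'b) cat
      \<Rightarrow> ('o, 'a, 'p, 'b) funct \<Rightarrow> ('o, 'a, 'p, 'b) funct \<Rightarrow> enat" where
  "cD C D F G = (if \<exists>n. cD_le C D F G n then enat (LEAST n. cD_le C D F G n) else \<infinity>)"

end

theory Submission
  imports Defs
begin

text \<open>Post-composition with a functor \<open>H\<close> preserves homotopies: if \<open>K\<close> is a homotopy from \<open>F\<close>
  to \<open>G\<close> on a subcategory, then \<open>H \<circ> K\<close> is a homotopy from \<open>H \<circ> F\<close> to \<open>H \<circ> G\<close>, because its
  values at the two ends of the interval are \<open>H\<close> applied to those of \<open>K\<close>. So any geometric cover
  of \<open>C\<close> that witnesses a bound on the distance of \<open>F\<close> and \<open>G\<close> also witnesses that bound for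
  their composites with \<open>H\<close>, and the least such bound can only decrease.\<close>

lemma cat_functor_funct_comp:
  assumes "cat_functor C D F" and "cat_functor D E H"
  shows "cat_functor C E (funct_comp H F)"
proof -
  interpret F: cat_functor C D F by fact
  interpret H: cat_functor D E H by fact
  show ?thesis
    by unfold_locales
      (auto simp: funct_comp_def F.omap_in F.amap_in F.Dom_amap F.Cod_amap F.amap_Id F.amap_Comp
        H.omap_in H.amap_in H.Dom_amap H.Cod_amap H.amap_Id H.amap_Comp)
qed

lemma funct_at_funct_comp: "funct_at (funct_comp H K) i = funct_comp H (funct_at K i)"
  by (simp add: funct_at_def funct_comp_def comp_def)

lemma funct_eq_on_funct_comp:
  "funct_eq_on C F G \<Longrightarrow> funct_eq_on C (funct_comp H F) (funct_comp H G)"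
  by (simp add: funct_eq_on_def funct_comp_def)

lemma homotopic_funct_comp:
  assumes "homotopic C D F G" and "cat_functor D E H"
  shows "homotopic C E (funct_comp H F) (funct_comp H G)"
proof -
  from assms(1) obtain m K where K: "cat_functor (prod_cat C (interval_cat m)) D K"
    and ends: "funct_eq_on C (funct_at K 0) F" "funct_eq_on C (funct_at K m) G"
    unfolding homotopic_def by blast
  have "cat_functor (prod_cat C (interval_cat m)) E (funct_comp H K)"
    using K assms(2) by (rule cat_functor_funct_comp)
  moreover have "funct_eq_on C (funct_at (funct_comp H K) 0) (funct_comp H F)"
    and "funct_eq_on C (funct_at (funct_comp H K) m) (funct_comp H G)"
    using ends by (simp_all add: funct_at_funct_comp funct_eq_on_funct_comp)
  ultimately show ?thesis
    unfolding homotopic_def by blast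
qed

lemma cD_le_funct_comp:
  assumes "cD_le C D F G n" and "cat_functor D E H"
  shows "cD_le C E (funct_comp H F) (funct_comp H G) n"
  using assms homotopic_funct_comp unfolding cD_le_def by blast

lemma cD_le_enat:
  assumes "cD_le C D F G n"
  shows "cD C D F G \<le> enat n"
  using assms by (auto simp: cD_def intro: Least_le)

theorem proposition4p1:
  fixes C :: "('o, 'a) cat" and D :: "('p, 'b) cat" and E :: "('q, 'c) cat"
    and F G :: "('o, 'a, 'p, 'b) funct" and H :: "('p, 'b, 'q, 'c) funct"
  assumes "connected_category C" and "connected_category D" and "connected_category E"
    and "cat_functor C D F" and "cat_functor C D G" and "cat_functor D E H"
  shows "cD C E (funct_comp H F) (funct_comp H G) \<le> cD C D F G"
proof (cases "\<exists>n. cD_le C D F G n")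
  case True
  define n where "n = (LEAST n. cD_le C D F G n)"
  have "cD_le C D F G n"
    unfolding n_def using True by (rule LeastI_ex)
  then have "cD C E (funct_comp H F) (funct_comp H G) \<le> enat n"
    using assms(6) by (intro cD_le_enat cD_le_funct_comp)
  then show ?thesis
    using True by (simp add: cD_def n_def)
next
  case False
  then show ?thesis
    by (simp add: cD_def)
qed

end
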